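(* There exist a Hamiltonian $H\in C^\infty(\mathbb{R}^4)$ on the standard $b$-symplectic manifold $(\mathbb{R}^4,\frac{dx_1}{x_1}\wedge dy_1+dx_2\wedge dy_2)$ and a (small enough) constant $\varepsilon>0$ such that the Hamiltonian vector field $X_H$ has no singular periodic orbits and no periodic orbits away from the critical surfaces in any of the level sets $\Sigma_c=H^{-1}(c)$, $c\in(1-\varepsilon,1+\varepsilon)$. Furthermore, these level sets are all diffeomorphic to $\mathbb{S}^3$.
   Context: The $b$-manifold $(\mathbb{R}^4,\{x_1=0\})$ has coordinates $(x_1,y_1,x_2,y_2)$ and critical set $\{x_1=0\}$; $b$-vector fields are the smooth vector fields tangent to $\{x_1=0\}$. The form $\omega=\frac{dx_1}{x_1}\wedge dy_1+dx_2\wedge dy_2$ is non-degenerate on the $b$-tangent bundle (the bundle whose sections are the $b$-vector fields), and the Hamiltonian vector field $X_H$ is the $b$-vector field determined by $\iota_{X_H}\omega=-dH$, i.e. $X_H=-x_1\frac{\partial H}{\partial y_1}\partial_{x_1}+x_1\frac{\partial H}{\partial x_1}\partial_{y_1}-\frac{\partial H}{\partial y_2}\partial_{x_2}+\frac{\partial H}{\partial x_2}\partial_{y_2}$. The critical surface of $\Sigma_c$ is $Z_c=\Sigma_c\cap\{x_1=0\}$. A singular periodic orbit in $\Sigma_c$ is an integral curve $\gamma:\mathbb{R}\to\Sigma_c\setminus Z_c$ of $X_H$ such that $\lim_{t\to\pm\infty}\gamma(t)=p_\pm\in Z_c$ (both limits exist as single points). *)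

theory Defs
  imports "HOL-Analysis.Analysis"
begin

section \<open>Smooth maps and diffeomorphisms\<close>

text \<open>Class \<open>C\<^sup>k\<close> and \<open>C\<^sup>\<infinity>\<close> on an open set \<open>S\<close>, by iterated directional derivatives.
  The notion is meant for finite-dimensional domains.\<close>

primrec Ck_on :: "nat \<Rightarrow> 'a::real_normed_vector set \<Rightarrow> ('a \<Rightarrow> 'b::real_normed_vector) \<Rightarrow> bool" where
  "Ck_on 0 S f \<longleftrightarrow> continuous_on S f"
| "Ck_on (Suc k) S f \<longleftrightarrow> (\<forall>x\<in>S. f differentiable (at x)) \<and>
     (\<forall>v. Ck_on k S (\<lambda>x. frechet_derivative f (at x) v))"

definition smooth_on :: "'a::real_normed_vector set \<Rightarrow> ('a \<Rightarrow> 'b::real_normed_vector) \<Rightarrow> bool" where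
  "smooth_on S f \<longleftrightarrow> (\<forall>k. Ck_on k S f)"

text \<open>Smoothness of a map on an arbitrary subset of a Euclidean space: near every point it is the
  restriction of a smooth map defined on an open set. On an embedded submanifold this is
  smoothness in the usual sense. A subset diffeomorphic, in the sense below, to an embedded
  submanifold is itself an embedded submanifold.\<close>

definition smooth_map_on :: "'a::euclidean_space set \<Rightarrow> ('a \<Rightarrow> 'b::euclidean_space) \<Rightarrow> bool" where
  "smooth_map_on S f \<longleftrightarrow>
     (\<forall>x\<in>S. \<exists>U F. open U \<and> x \<in> U \<and> smooth_on U F \<and> (\<forall>y\<in>U \<inter> S. F y = f y))"

definition diffeomorphic_sets :: "'a::euclidean_space set \<Rightarrow> 'b::euclidean_space set \<Rightarrow> bool" where
  "diffeomorphic_sets S T \<longleftrightarrow>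
     (\<exists>f g. homeomorphism S T f g \<and> smooth_map_on S f \<and> smooth_map_on T g)"

section \<open>The standard \<open>b\<close>-symplectic structure on \<open>\<real>\<^sup>4\<close>\<close>

text \<open>The components \<open>1, 2, 3, 4\<close> of a point are the coordinates \<open>x\<^sub>1, y\<^sub>1, x\<^sub>2, y\<^sub>2\<close>.\<close>

definition critical_set :: "(real ^ 4) set" where
  "critical_set = {p. p $ 1 = 0}"

text \<open>The fibre of the \<open>b\<close>-tangent bundle at \<open>p\<close> is identified with \<open>real ^ 4\<close> by means of the global
  frame \<open>x\<^sub>1 \<partial>/\<partial>x\<^sub>1, \<partial>/\<partial>y\<^sub>1, \<partial>/\<partial>x\<^sub>2, \<partial>/\<partial>y\<^sub>2\<close>; the anchor sends a \<open>b\<close>-tangent vector, given by its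
  coefficients in this frame, to the underlying ordinary tangent vector.\<close>

definition b_anchor :: "real ^ 4 \<Rightarrow> real ^ 4 \<Rightarrow> real ^ 4" where
  "b_anchor p a = vector [p $ 1 * a $ 1, a $ 2, a $ 3, a $ 4]"

text \<open>The form \<open>dx\<^sub>1/x\<^sub>1 \<and> dy\<^sub>1 + dx\<^sub>2 \<and> dy\<^sub>2\<close> on the \<open>b\<close>-tangent bundle. Since \<open>dx\<^sub>1/x\<^sub>1\<close> takes the
  value \<open>1\<close> on \<open>x\<^sub>1 \<partial>/\<partial>x\<^sub>1\<close>, the coframe \<open>dx\<^sub>1/x\<^sub>1, dy\<^sub>1, dx\<^sub>2, dy\<^sub>2\<close> is dual to this frame and the matrix of
  the two-form does not depend on the point; see \<open>b_form_off_critical_set\<close>.\<close>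

definition b_form :: "real ^ 4 \<Rightarrow> real ^ 4 \<Rightarrow> real" where
  "b_form a b = (a $ 1 * b $ 2 - a $ 2 * b $ 1) + (a $ 3 * b $ 4 - a $ 4 * b $ 3)"

definition b_hamiltonian_coeffs :: "(real ^ 4 \<Rightarrow> real) \<Rightarrow> real ^ 4 \<Rightarrow> real ^ 4" where
  "b_hamiltonian_coeffs H p =
     (THE a. \<forall>b. b_form a b = - frechet_derivative H (at p) (b_anchor p b))"

definition hamiltonian_vf :: "(real ^ 4 \<Rightarrow> real) \<Rightarrow> real ^ 4 \<Rightarrow> real ^ 4" where
  "hamiltonian_vf H p = b_anchor p (b_hamiltonian_coeffs H p)"

section \<open>Level sets and orbits\<close>

definition level_set :: "(real ^ 4 \<Rightarrow> real) \<Rightarrow> real \<Rightarrow> (real ^ 4) set" where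
  "level_set H c = {p. H p = c}"

definition critical_surface :: "(real ^ 4 \<Rightarrow> real) \<Rightarrow> real \<Rightarrow> (real ^ 4) set" where
  "critical_surface H c = level_set H c \<inter> critical_set"

definition integral_curve :: "(real ^ 4 \<Rightarrow> real ^ 4) \<Rightarrow> (real \<Rightarrow> real ^ 4) \<Rightarrow> bool" where
  "integral_curve X \<gamma> \<longleftrightarrow> (\<forall>t. (\<gamma> has_vector_derivative X (\<gamma> t)) (at t))"

definition singular_periodic_orbit ::
    "(real ^ 4 \<Rightarrow> real) \<Rightarrow> real \<Rightarrow> (real \<Rightarrow> real ^ 4) \<Rightarrow> bool" where
  "singular_periodic_orbit H c \<gamma> \<longleftrightarrow>
     integral_curve (hamiltonian_vf H) \<gamma> \<and>
     range \<gamma> \<subseteq> level_set H c - critical_surface H c \<and>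
     (\<exists>p\<in>critical_surface H c. (\<gamma> \<longlongrightarrow> p) at_top) \<and>
     (\<exists>p\<in>critical_surface H c. (\<gamma> \<longlongrightarrow> p) at_bot)"

text \<open>Equilibria are not excluded here: a constant integral curve away from the critical surface
  counts as periodic. On a regular level set there are none.\<close>

definition periodic_orbit_off_critical ::
    "(real ^ 4 \<Rightarrow> real) \<Rightarrow> real \<Rightarrow> (real \<Rightarrow> real ^ 4) \<Rightarrow> bool" where
  "periodic_orbit_off_critical H c \<gamma> \<longleftrightarrow>
     integral_curve (hamiltonian_vf H) \<gamma> \<and>
     range \<gamma> \<subseteq> level_set H c - critical_surface H c \<and>
     (\<exists>T>0. \<forall>t. \<gamma> (t + T) = \<gamma> t)"

section \<open>Basic facts\<close>

lemma vector_4_nth [simp]: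
  "(vector [a, b, c, d] :: 'a::zero ^ 4) $ 1 = a"
  "(vector [a, b, c, d] :: 'a::zero ^ 4) $ 2 = b"
  "(vector [a, b, c, d] :: 'a::zero ^ 4) $ 3 = c"
  "(vector [a, b, c, d] :: 'a::zero ^ 4) $ 4 = d"
  unfolding vector_def by simp_all

lemma b_form_off_critical_set:
  fixes a b p :: "real ^ 4"
  defines "u \<equiv> b_anchor p a" and "v \<equiv> b_anchor p b"
  assumes "p \<notin> critical_set"
  shows "b_form a b = (u $ 1 * v $ 2 - u $ 2 * v $ 1) / p $ 1 + (u $ 3 * v $ 4 - u $ 4 * v $ 3)"
  using assms by (simp add: b_form_def b_anchor_def critical_set_def field_simps)

lemma b_form_nondegenerate:
  assumes "\<And>b. b_form a b = b_form a' b"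
  shows "a = a'"
  using assms[of "axis 1 1"] assms[of "axis 2 1"] assms[of "axis 3 1"] assms[of "axis 4 1"]
  by (simp add: b_form_def axis_def vec_eq_iff forall_4)

lemma b_hamiltonian_coeffs_eq:
  fixes H :: "real ^ 4 \<Rightarrow> real"
  assumes "H differentiable (at p)"
  shows "b_hamiltonian_coeffs H p =
    vector [- frechet_derivative H (at p) (axis 2 1),
            p $ 1 * frechet_derivative H (at p) (axis 1 1),
            - frechet_derivative H (at p) (axis 4 1),
            frechet_derivative H (at p) (axis 3 1)]" (is "_ = ?a")
proof -
  let ?D = "frechet_derivative H (at p)"
  have lin: "linear ?D"
    using assms by (rule linear_frechet_derivative)
  have eq: "b_form ?a b = - ?D (b_anchor p b)" for b
  proof -
    have *: "b_anchor p b = (p $ 1 * b $ 1) *\<^sub>R axis 1 1 + b $ 2 *\<^sub>R axis 2 1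
        + b $ 3 *\<^sub>R axis 3 1 + b $ 4 *\<^sub>R axis 4 1"
      by (simp add: b_anchor_def axis_def vec_eq_iff forall_4)
    show ?thesis
      unfolding * by (simp add: linear_add[OF lin] linear_scale[OF lin] b_form_def)
  qed
  show ?thesis
    unfolding b_hamiltonian_coeffs_def
    by (rule the_equality) (auto simp: eq intro: b_form_nondegenerate)
qed

lemma hamiltonian_vf_eq:
  fixes H :: "real ^ 4 \<Rightarrow> real"
  assumes "H differentiable (at p)"
  shows "hamiltonian_vf H p =
    vector [- p $ 1 * frechet_derivative H (at p) (axis 2 1),
            p $ 1 * frechet_derivative H (at p) (axis 1 1),
            - frechet_derivative H (at p) (axis 4 1),
            frechet_derivative H (at p) (axis 3 1)]"
  by (simp add: hamiltonian_vf_def b_hamiltonian_coeffs_eq[OF assms] b_anchor_def)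

end

theory Submission
  imports Defs
begin

text \<open>
  The Hamiltonian is the positive definite quadratic form
  \<open>H = x\<^sub>1\<^sup>2 + y\<^sub>1\<^sup>2 + ((x\<^sub>2 + k y\<^sub>1)\<^sup>2 + y\<^sub>2\<^sup>2) / 2\<close> with a small coupling \<open>k \<noteq> 0\<close>. Its level sets with
  \<open>c > 0\<close> are ellipsoids, hence linearly diffeomorphic to the sphere.

  Put \<open>u = x\<^sub>1\<^sup>2\<close>, \<open>p = x\<^sub>2 + k y\<^sub>1\<close>, \<open>q = y\<^sub>2\<close> and \<open>y = y\<^sub>1\<close>. Then \<open>y' = 2 u\<close>, so \<open>y\<close> increases strictly away
  from the critical set, which excludes periodic orbits there. Moreover \<open>p' = - q + k y'\<close> and \<open>q' = p\<close>:
  the pair \<open>(p, q)\<close> is a harmonic oscillator forced by \<open>k y'\<close>.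

  For \<open>k = 0\<close> the oscillator decouples, and exactly one orbit in each half space \<open>x\<^sub>1 > 0\<close> and
  \<open>x\<^sub>1 < 0\<close> of a level set is singular periodic: the one that runs from \<open>y = - sqrt c\<close> to
  \<open>y = sqrt c\<close> with the oscillator at rest. The coupling breaks this
  connection. Limit points of a convergent orbit are equilibria, so a singular periodic orbit would
  have the oscillator at rest at both ends of time, that is, the Fourier coefficient
  \<open>\<integral> y' exp (- \<i> t) dt\<close> of the force would vanish. But the force is positive and
  concentrated: with \<open>t0\<close> the time at which \<open>y = 0\<close>, more than two thirds of the total increase
  \<open>2 sqrt c\<close> of \<open>y\<close> happen for \<open>\<bar>t - t0\<bar> \<le> 1\<close>, where \<open>cos (t - t0) \<ge> 1 / 2\<close>. The contribution of this window
  to the real part of the coefficient (with the phase origin at \<open>t0\<close>) exceeds what the remaining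
  times can cancel.

  The argument about the oscillator is \<open>forced_oscillator_not_at_rest_at_both_ends\<close>; the integral appears
  there through the function \<open>p cos (t - s) + q sin (t - s)\<close>, whose derivative is
  \<open>k y' cos (t - s)\<close>, so that only monotonicity arguments are needed.
\<close>

section \<open>Monotone and convergent functions on the line\<close>

lemma nonneg_derivative_bounded_by_limits:
  fixes f :: "real \<Rightarrow> real"
  assumes der: "\<And>t. (f has_real_derivative f' t) (at t)" and nonneg: "\<And>t. f' t \<ge> 0"
  shows "(f \<longlongrightarrow> l) at_top \<Longrightarrow> f t \<le> l" and "(f \<longlongrightarrow> l) at_bot \<Longrightarrow> l \<le> f t"
proof -
  have mono: "f s \<le> f t" if "s \<le> t" for s t
    using DERIV_nonneg_imp_nondecreasing[OF that, of f] der nonneg by blast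
  show "f t \<le> l" if "(f \<longlongrightarrow> l) at_top"
    by (rule tendsto_lowerbound[OF that])
       (auto intro: eventually_mono[OF eventually_ge_at_top[of t]] mono)
  show "l \<le> f t" if "(f \<longlongrightarrow> l) at_bot"
    by (rule tendsto_upperbound[OF that])
       (auto intro: eventually_mono[OF eventually_le_at_bot[of t]] mono)
qed

text \<open>By the mean value theorem on \<open>[t, t + 1]\<close>, the derivative takes, at arbitrarily late times, values
  close to \<open>f (t + 1) - f t\<close>, which tends to zero. This is why limit points of convergent integral
  curves are equilibria.\<close>

lemma limit_of_derivative_eq_0_at_top:
  fixes f :: "real \<Rightarrow> real"
  assumes der: "\<And>t. (f has_real_derivative f' t) (at t)"
    and lim: "(f \<longlongrightarrow> l) at_top" and lim': "(f' \<longlongrightarrow> m) at_top"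
  shows "m = 0"
proof -
  have "\<exists>z>t. f (t + 1) - f t = f' z" for t
    using MVT2[of t "t + 1" f f'] der by force
  then obtain z where z: "\<And>t. z t > t" "\<And>t. f (t + 1) - f t = f' (z t)"
    by metis
  have "filterlim z at_top at_top"
    by (rule filterlim_at_top_mono[OF filterlim_ident]) (auto intro: always_eventually less_imp_le z)
  then have "((\<lambda>t. f' (z t)) \<longlongrightarrow> m) at_top"
    by (rule filterlim_compose[OF lim'])
  moreover have "filterlim (\<lambda>t::real. t + 1) at_top at_top"
    by (rule filterlim_at_top_mono[OF filterlim_ident]) auto
  then have "((\<lambda>t. f (t + 1) - f t) \<longlongrightarrow> l - l) at_top"
    by (intro tendsto_diff lim filterlim_compose[OF lim])
  ultimately show ?thesis
    using tendsto_unique[OF trivial_limit_at_top_linorder] by (fastforce simp: z(2))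
qed

lemma limit_of_derivative_eq_0_at_bot:
  fixes f :: "real \<Rightarrow> real"
  assumes der: "\<And>t. (f has_real_derivative f' t) (at t)"
    and lim: "(f \<longlongrightarrow> l) at_bot" and lim': "(f' \<longlongrightarrow> m) at_bot"
  shows "m = 0"
proof -
  have "((\<lambda>t. f (- t)) has_real_derivative - f' (- t)) (at t)" for t
    using DERIV_mirror[of f "f' (- t)" t] der[of "- t"] by blast
  moreover have "((\<lambda>t. f (- t)) \<longlongrightarrow> l) at_top" "((\<lambda>t. - f' (- t)) \<longlongrightarrow> - m) at_top"
    using lim lim' by (auto simp: filterlim_at_bot_mirror intro: tendsto_minus)
  ultimately show ?thesis
    using limit_of_derivative_eq_0_at_top by fastforce
qed

section \<open>The forced oscillator\<close>

text \<open>The total force is the increase of \<open>k y\<close>. If the oscillator is at rest at both ends, its amplitude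
  is at most the force that has acted, so it is of order \<open>k\<close> and, for small \<open>k\<close>, hardly slows down \<open>y\<close>.
  Hence \<open>y\<close> needs less than one unit of time to go from \<open>0\<close> to \<open>2/3\<close> of its limit, in either time
  direction. The lower bound on \<open>c\<close> is what makes one unit of time suffice, and one unit is chosen
  because \<open>1 < \<pi> / 3\<close>. The conclusion then compares the window \<open>[t0 - 1, t0 + 1]\<close> with the rest of the
  line.\<close>

lemma forced_oscillator_not_at_rest_at_both_ends:
  fixes y p q u :: "real \<Rightarrow> real" and c k :: real
  assumes k: "0 < k" "k \<le> 1 / 10" and c: "c > 4 / 9"
    and dy: "\<And>t. (y has_real_derivative 2 * u t) (at t)"
    and dp: "\<And>t. (p has_real_derivative - q t + k * (2 * u t)) (at t)"
    and dq: "\<And>t. (q has_real_derivative p t) (at t)"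
    and energy: "\<And>t. u t + (y t)\<^sup>2 + ((p t)\<^sup>2 + (q t)\<^sup>2) / 2 = c"
    and u_pos: "\<And>t. u t > 0"
    and y_top: "(y \<longlongrightarrow> a) at_top" and p_top: "(p \<longlongrightarrow> 0) at_top" and q_top: "(q \<longlongrightarrow> 0) at_top"
    and y_bot: "(y \<longlongrightarrow> b) at_bot" and p_bot: "(p \<longlongrightarrow> 0) at_bot" and q_bot: "(q \<longlongrightarrow> 0) at_bot"
    and u_top: "(u \<longlongrightarrow> 0) at_top" and u_bot: "(u \<longlongrightarrow> 0) at_bot"
  shows False
proof -
  define r where "r = sqrt c"
  have r: "r > 2 / 3" "r\<^sup>2 = c"
    using c real_less_rsqrt[of "2/3" c] by (auto simp: r_def power2_eq_square)
  have y_incr: "y s < y t" if "s < t" for s t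
    by (rule DERIV_pos_imp_increasing[OF that]) (metis dy u_pos zero_less_mult_iff zero_less_numeral)
  have y_less_a: "y t < a" and b_less_y: "b < y t" for t
    using y_incr[of t "t + 1"] y_incr[of "t - 1" t] u_pos
      nonneg_derivative_bounded_by_limits[OF dy, of a "t + 1"]
      nonneg_derivative_bounded_by_limits[OF dy, of b "t - 1"] y_top y_bot
    by (force simp: less_imp_le)+
  \<comment> \<open>By conservation of energy the two limits of \<open>y\<close> are the two square roots of \<open>c\<close>.\<close>
  have "((\<lambda>t. u t + (y t)\<^sup>2 + ((p t)\<^sup>2 + (q t)\<^sup>2) / 2) \<longlongrightarrow> 0 + a\<^sup>2 + (0\<^sup>2 + 0\<^sup>2) / 2) at_top"
    by (intro tendsto_intros u_top y_top p_top q_top) simp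
  then have "a\<^sup>2 = r\<^sup>2"
    unfolding energy r(2) by (simp add: tendsto_const_iff)
  moreover have "((\<lambda>t. u t + (y t)\<^sup>2 + ((p t)\<^sup>2 + (q t)\<^sup>2) / 2) \<longlongrightarrow> 0 + b\<^sup>2 + (0\<^sup>2 + 0\<^sup>2) / 2) at_bot"
    by (intro tendsto_intros u_bot y_bot p_bot q_bot) simp
  then have "b\<^sup>2 = r\<^sup>2"
    unfolding energy r(2) by (simp add: tendsto_const_iff)
  moreover have "b < a"
    using y_less_a[of 0] b_less_y[of 0] by simp
  ultimately have ab: "a = r" "b = - r"
    using r by (auto simp: power2_eq_iff)

  \<comment> \<open>\<open>F s\<close> is a component of the oscillator in the frame that rotates with it, with phase origin \<open>s\<close>.\<close>
  define F where "F s t = p t * cos (t - s) + q t * sin (t - s)" for s t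
  have dF: "(F s has_real_derivative k * (2 * u t) * cos (t - s)) (at t)" for s t
    unfolding F_def
    by (rule derivative_eq_intros dp dq refl)+ (simp add: algebra_simps)
  have F_lim: "(F s \<longlongrightarrow> 0) G" if "(p \<longlongrightarrow> 0) G" "(q \<longlongrightarrow> 0) G" for s G
  proof (rule Lim_null_comparison)
    show "((\<lambda>t. \<bar>p t\<bar> + \<bar>q t\<bar>) \<longlongrightarrow> 0) G"
      using tendsto_add[OF tendsto_rabs[OF that(1)] tendsto_rabs[OF that(2)]] by simp
    have "norm (F s t) \<le> \<bar>p t\<bar> + \<bar>q t\<bar>" for t
      unfolding F_def real_norm_def
      by (rule order_trans[OF abs_triangle_ineq])
         (auto simp: abs_mult intro!: add_mono mult_left_le)
    then show "\<forall>\<^sub>F t in G. norm (F s t) \<le> \<bar>p t\<bar> + \<bar>q t\<bar>"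
      by simp
  qed
  \<comment> \<open>Both \<open>k y + F s\<close> and \<open>k y - F s\<close> increase, since the cosine is at most \<open>1\<close> in absolute value.\<close>
  have d: "((\<lambda>t. k * y t + e * F s t) has_real_derivative k * (2 * u t) * (1 + e * cos (t - s))) (at t)"
    for e s t
    by (rule derivative_eq_intros dy dF refl)+ (simp add: algebra_simps)
  have nonneg: "k * (2 * u t) * (1 + e * cos (t - s)) \<ge> 0" if "\<bar>e\<bar> = 1" for e s t
  proof -
    have "\<bar>e * cos (t - s)\<bar> \<le> 1"
      using that by (simp add: abs_mult)
    then show ?thesis
      using k u_pos[of t] by (intro mult_nonneg_nonneg) auto
  qed
  have F_top: "k * y t + e * F s t \<le> k * r" if "\<bar>e\<bar> = 1" for e s t
    by (rule nonneg_derivative_bounded_by_limits(1)[OF d nonneg[OF that]])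
       (use ab in \<open>auto intro!: tendsto_eq_intros y_top F_lim p_top q_top\<close>)
  have F_bot: "- k * r \<le> k * y t + e * F s t" if "\<bar>e\<bar> = 1" for e s t
    by (rule nonneg_derivative_bounded_by_limits(2)[OF d nonneg[OF that]])
       (use ab in \<open>auto intro!: tendsto_eq_intros y_bot F_lim p_bot q_bot\<close>)

  have F_bound: "\<bar>F s t\<bar> \<le> 2 * k * r" for s t
  proof -
    have "k * y t \<le> k * r"
      using k y_less_a[of t] ab by (intro mult_left_mono) auto
    then show ?thesis
      using F_bot[of 1 t s] F_bot[of "-1" t s] by (simp add: abs_le_iff)
  qed
  have amplitude: "((p t)\<^sup>2 + (q t)\<^sup>2) / 2 \<le> c / 18" for t
  proof -
    have "2 * k * r \<le> r / 5"
      using k r mult_right_mono[of k "1/10" r] by simp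
    \<comment> \<open>The phase origins \<open>t\<close> and \<open>t - pi / 2\<close> single out \<open>p t\<close> and \<open>q t\<close>.\<close>
    then have "\<bar>p t\<bar> \<le> r / 5" "\<bar>q t\<bar> \<le> r / 5"
      using F_bound[of t t] F_bound[of "t - pi / 2" t] by (auto simp: F_def)
    then have "(p t)\<^sup>2 \<le> (r / 5)\<^sup>2" "(q t)\<^sup>2 \<le> (r / 5)\<^sup>2"
      using r by (auto simp: abs_le_square_iff[symmetric])
    then show ?thesis
      using c by (simp add: power_divide r(2))
  qed
  have fast: "y s + c \<le> y (s + 1)" if "\<bar>y s\<bar> \<le> 2 / 3 * r" "\<bar>y (s + 1)\<bar> \<le> 2 / 3 * r" for s
  proof -
    obtain z where z: "s < z" "z < s + 1" "y (s + 1) - y s = 2 * u z"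
      using MVT2[of s "s + 1" y "\<lambda>t. 2 * u t"] dy by auto
    have "\<bar>y z\<bar> \<le> 2 / 3 * r"
      using that y_incr[OF z(1)] y_incr[OF z(2)] by auto
    then have "(y z)\<^sup>2 \<le> (2 / 3 * r)\<^sup>2"
      using r by (auto simp: abs_le_square_iff[symmetric])
    then have "(y z)\<^sup>2 \<le> 4 / 9 * c"
      unfolding power_mult_distrib r(2) by (simp add: power2_eq_square)
    then show ?thesis
      using energy[of z] amplitude[of z] z(3) by linarith
  qed

  obtain t0 where t0: "y t0 = 0"
  proof -
    have "\<forall>\<^sub>F t in at_top. y t > 0" "\<forall>\<^sub>F t in at_bot. y t < 0"
      using order_tendstoD[OF y_top] order_tendstoD[OF y_bot] r ab by auto
    then obtain t1 t2 where t: "y t1 < 0" "y t2 > 0"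
      by (meson eventually_happens trivial_limit_at_bot_linorder trivial_limit_at_top_linorder)
    then have "t1 < t2"
      using y_incr by (metis less_asym linorder_less_linear order.strict_trans)
    then show ?thesis
      using IVT[of y t1 0 t2] t that DERIV_isCont[OF dy] by auto
  qed
  have "c > 2 / 3 * r"
    using r mult_strict_right_mono[of "2/3" r r] by (simp add: power2_eq_square)
  then have "\<not> \<bar>y (t0 + 1)\<bar> \<le> 2 / 3 * r" "\<not> \<bar>y (t0 - 1)\<bar> \<le> 2 / 3 * r"
    using fast[of t0] fast[of "t0 - 1"] t0 r by auto
  then have late: "y (t0 + 1) > 2 / 3 * r" and early: "y (t0 - 1) < - (2 / 3 * r)"
    using t0 y_incr[of t0 "t0 + 1"] y_incr[of "t0 - 1" t0] by linarith+

  \<comment> \<open>On the window, \<open>F t0\<close> gains at least \<open>k / 2\<close> times the increase of \<open>y\<close>; before and after it,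
    \<open>F t0\<close> changes by at most \<open>k\<close> times the increase of \<open>y\<close>. Its total change being zero, the
    increase on the window is at most \<open>4 / 3 * r\<close>.\<close>
  have "k / 2 * y (t0 + 1) - F t0 (t0 + 1) \<le> k / 2 * y (t0 - 1) - F t0 (t0 - 1)"
  proof (rule DERIV_nonpos_imp_nonincreasing[of "t0 - 1" "t0 + 1" "\<lambda>t. k / 2 * y t - F t0 t"])
    fix t assume t: "t0 - 1 \<le> t" "t \<le> t0 + 1"
    have "\<bar>t - t0\<bar> \<le> pi / 3"
      using t pi_gt3 by linarith
    then have "cos (pi / 3) \<le> cos \<bar>t - t0\<bar>"
      by (intro cos_monotone_0_pi_le) auto
    then have "cos (t - t0) \<ge> 1 / 2"
      by (simp add: cos_60)
    then have "k * (2 * u t) * (1 / 2 - cos (t - t0)) \<le> 0"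
      using k u_pos[of t] by (intro mult_nonneg_nonpos) auto
    moreover have "((\<lambda>t. k / 2 * y t - F t0 t) has_real_derivative
        k * (2 * u t) * (1 / 2 - cos (t - t0))) (at t)"
      by (rule derivative_eq_intros dy dF refl)+ (simp add: algebra_simps)
    ultimately show "\<exists>m. ((\<lambda>t. k / 2 * y t - F t0 t) has_real_derivative m) (at t) \<and> m \<le> 0"
      by blast
  qed auto
  with F_top[of 1 "t0 + 1" t0] F_bot[of 1 "t0 - 1" t0]
  have "k * (3 / 2 * (y (t0 + 1) - y (t0 - 1)) - 2 * r) \<le> 0"
    by (simp add: algebra_simps)
  then have "3 / 2 * (y (t0 + 1) - y (t0 - 1)) \<le> 2 * r"
    using k by (simp add: mult_le_0_iff)
  then show False
    using late early by simp
qed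

section \<open>The coupled quadratic Hamiltonian\<close>

definition coupled_energy :: "real \<Rightarrow> real ^ 4 \<Rightarrow> real" where
  "coupled_energy k v = (v $ 1)\<^sup>2 + (v $ 2)\<^sup>2 + ((v $ 3 + k * v $ 2)\<^sup>2 + (v $ 4)\<^sup>2) / 2"

lemma has_derivative_coupled_energy:
  "(coupled_energy k has_derivative
     (\<lambda>w. 2 * v $ 1 * w $ 1 + 2 * v $ 2 * w $ 2
        + (v $ 3 + k * v $ 2) * (w $ 3 + k * w $ 2) + v $ 4 * w $ 4)) (at v)"
  unfolding coupled_energy_def[abs_def]
  by (auto intro!: derivative_eq_intros bounded_linear_imp_has_derivative[OF bounded_linear_vec_nth]
      simp: fun_eq_iff field_simps)

lemmas frechet_derivative_coupled_energy = frechet_derivative_at[OF has_derivative_coupled_energy, symmetric]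

lemma hamiltonian_vf_coupled_energy:
  "hamiltonian_vf (coupled_energy k) v =
     vector [- v $ 1 * (2 * v $ 2 + k * (v $ 3 + k * v $ 2)), 2 * (v $ 1)\<^sup>2, - v $ 4, v $ 3 + k * v $ 2]"
proof -
  have "coupled_energy k differentiable (at v)"
    using has_derivative_coupled_energy differentiableI by blast
  then show ?thesis
    by (simp add: hamiltonian_vf_eq frechet_derivative_coupled_energy axis_def power2_eq_square
        algebra_simps)
qed

lemma Ck_on_const: "Ck_on n S (\<lambda>x. a)"
  by (induction n arbitrary: a) auto

lemma bounded_linear_imp_smooth_on:
  assumes "bounded_linear f"
  shows "smooth_on S f"
proof -
  have "frechet_derivative f (at x) = f" for x
    by (rule frechet_derivative_at[OF bounded_linear_imp_has_derivative[OF assms], symmetric])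
  then have "Ck_on n S f" for n
    using bounded_linear_imp_differentiable[OF assms] linear_continuous_on[OF assms]
    by (cases n) (auto simp: Ck_on_const)
  then show ?thesis
    by (simp add: smooth_on_def)
qed

lemma bounded_linear_imp_smooth_map_on: "bounded_linear f \<Longrightarrow> smooth_map_on S f"
  unfolding smooth_map_on_def using bounded_linear_imp_smooth_on open_UNIV by blast

lemma smooth_on_coupled_energy: "smooth_on S (coupled_energy k)"
proof -
  have "bounded_linear (\<lambda>v. frechet_derivative (coupled_energy k) (at v) w)" for w
    unfolding frechet_derivative_coupled_energy
    by (intro bounded_linear_add bounded_linear_const_mult
        bounded_linear_mult_const bounded_linear_vec_nth)
  then have "Ck_on n S (\<lambda>v. frechet_derivative (coupled_energy k) (at v) w)" for n w
    using bounded_linear_imp_smooth_on by (auto simp: smooth_on_def)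
  moreover have "coupled_energy k differentiable (at v)" for v
    using has_derivative_coupled_energy differentiableI by blast
  moreover from this have "continuous_on S (coupled_energy k)"
    by (simp add: continuous_at_imp_continuous_on differentiable_imp_continuous_within)
  ultimately have "Ck_on n S (coupled_energy k)" for n
    by (cases n) auto
  then show ?thesis
    by (simp add: smooth_on_def)
qed

lemma diffeomorphic_sets_linear:
  fixes f :: "'a::euclidean_space \<Rightarrow> 'b::euclidean_space"
  assumes f: "bounded_linear f" and g: "bounded_linear g"
    and fg: "\<And>x. g (f x) = x" "\<And>y. f (g y) = y"
    and ST: "\<And>x. f x \<in> T \<longleftrightarrow> x \<in> S"
  shows "diffeomorphic_sets S T"
proof -
  have gS: "g y \<in> S" if "y \<in> T" for y
    using ST[of "g y"] that fg by simp
  have "homeomorphism S T f g"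
    using assms gS
    by (intro homeomorphismI) (auto intro: linear_continuous_on)
  then show ?thesis
    unfolding diffeomorphic_sets_def
    using bounded_linear_imp_smooth_map_on[OF f] bounded_linear_imp_smooth_map_on[OF g] by blast
qed

text \<open>Completing the square has already put the form into diagonal shape in the coordinates
  \<open>(x\<^sub>1, y\<^sub>1, x\<^sub>2 + k y\<^sub>1, y\<^sub>2)\<close>, so shearing and rescaling the axes maps the ellipsoid to the sphere.\<close>

lemma level_set_coupled_energy_diffeomorphic_sphere:
  assumes "c > 0"
  shows "diffeomorphic_sets (level_set (coupled_energy k) c) (sphere (0 :: real ^ 4) 1)"
proof -
  define r where "r = sqrt c"
  define s where "s = sqrt 2"
  have r: "r > 0" "r\<^sup>2 = c" and s: "s > 0" "s\<^sup>2 = 2"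
    using assms by (auto simp: r_def s_def)
  define f :: "real ^ 4 \<Rightarrow> real ^ 4"
    where "f v = vector [v $ 1 / r, v $ 2 / r, (v $ 3 + k * v $ 2) / (r * s), v $ 4 / (r * s)]" for v
  define g :: "real ^ 4 \<Rightarrow> real ^ 4"
    where "g w = vector [r * w $ 1, r * w $ 2, r * s * w $ 3 - k * (r * w $ 2), r * s * w $ 4]" for w
  have "linear f" "linear g"
    by (rule linearI; simp add: f_def g_def vec_eq_iff forall_4 algebra_simps add_divide_distrib)+
  then have fg: "bounded_linear f" "bounded_linear g"
    by (auto simp: linear_conv_bounded_linear)
  have inv: "g (f x) = x" "f (g x) = x" for x
    using r s by (auto simp: f_def g_def vec_eq_iff forall_4)
  have "f v \<in> sphere 0 1 \<longleftrightarrow> v \<in> level_set (coupled_energy k) c" for v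
  proof -
    have sq: "(a / (r * s))\<^sup>2 = a\<^sup>2 / (2 * c)" for a
      by (simp add: power_divide power_mult_distrib r s)
    have "norm (f v) ^ 2 = coupled_energy k v / c"
      unfolding power2_norm_eq_inner
      by (simp add: inner_vec_def sum_4 f_def coupled_energy_def flip: power2_eq_square)
         (use assms in \<open>simp add: sq power_divide[of _ r] r s field_simps\<close>)
    moreover have "norm (f v) = 1 \<longleftrightarrow> norm (f v) ^ 2 = 1"
      using power2_eq_iff_nonneg[of "norm (f v)" 1] by simp
    ultimately show ?thesis
      using assms by (auto simp: level_set_def)
  qed
  then show ?thesis
    by (rule diffeomorphic_sets_linear[OF fg inv])
qed

section \<open>Orbits of the coupled Hamiltonian\<close>

lemma integral_curve_coupled_energy_derivatives:
  assumes "integral_curve (hamiltonian_vf (coupled_energy k)) \<gamma>"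
  shows "((\<lambda>t. \<gamma> t $ 2) has_real_derivative 2 * (\<gamma> t $ 1)\<^sup>2) (at t)"
    and "((\<lambda>t. \<gamma> t $ 3) has_real_derivative - \<gamma> t $ 4) (at t)"
    and "((\<lambda>t. \<gamma> t $ 4) has_real_derivative \<gamma> t $ 3 + k * \<gamma> t $ 2) (at t)"
proof -
  have "((\<lambda>t. \<gamma> t $ i) has_real_derivative hamiltonian_vf (coupled_energy k) (\<gamma> t) $ i) (at t)" for i
    unfolding has_real_derivative_iff_has_vector_derivative
    by (rule bounded_linear.has_vector_derivative[OF bounded_linear_vec_nth])
       (use assms in \<open>simp add: integral_curve_def\<close>)
  from this[of 2] this[of 3] this[of 4]
  show "((\<lambda>t. \<gamma> t $ 2) has_real_derivative 2 * (\<gamma> t $ 1)\<^sup>2) (at t)"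
    and "((\<lambda>t. \<gamma> t $ 3) has_real_derivative - \<gamma> t $ 4) (at t)"
    and "((\<lambda>t. \<gamma> t $ 4) has_real_derivative \<gamma> t $ 3 + k * \<gamma> t $ 2) (at t)"
    by (simp_all add: hamiltonian_vf_coupled_energy)
qed

lemma no_periodic_orbit_off_critical_coupled_energy:
  "\<not> periodic_orbit_off_critical (coupled_energy k) c \<gamma>"
proof
  assume "periodic_orbit_off_critical (coupled_energy k) c \<gamma>"
  then obtain T where curve: "integral_curve (hamiltonian_vf (coupled_energy k)) \<gamma>"
    and off: "range \<gamma> \<subseteq> level_set (coupled_energy k) c - critical_surface (coupled_energy k) c"
    and T: "T > 0" "\<gamma> (0 + T) = \<gamma> 0"
    unfolding periodic_orbit_off_critical_def by blast
  have "\<gamma> t $ 1 \<noteq> 0" for t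
    using off by (auto simp: critical_surface_def critical_set_def)
  then have "2 * (\<gamma> t $ 1)\<^sup>2 > 0" for t
    by simp
  then have "\<gamma> 0 $ 2 < \<gamma> (0 + T) $ 2"
    using DERIV_pos_imp_increasing[of 0 "0 + T" "\<lambda>t. \<gamma> t $ 2"] T(1)
      integral_curve_coupled_energy_derivatives(1)[OF curve] by fastforce
  with T(2) show False
    by simp
qed

lemma no_singular_periodic_orbit_coupled_energy:
  assumes k: "0 < k" "k \<le> 1 / 10" and c: "c > 4 / 9"
  shows "\<not> singular_periodic_orbit (coupled_energy k) c \<gamma>"
proof
  assume "singular_periodic_orbit (coupled_energy k) c \<gamma>"
  then obtain a b where curve: "integral_curve (hamiltonian_vf (coupled_energy k)) \<gamma>"
    and off: "range \<gamma> \<subseteq> level_set (coupled_energy k) c - critical_surface (coupled_energy k) c"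
    and a: "a $ 1 = 0" "(\<gamma> \<longlongrightarrow> a) at_top" and b: "b $ 1 = 0" "(\<gamma> \<longlongrightarrow> b) at_bot"
    unfolding singular_periodic_orbit_def critical_surface_def critical_set_def by blast
  note d = integral_curve_coupled_energy_derivatives[OF curve]
  have top: "((\<lambda>t. \<gamma> t $ i) \<longlongrightarrow> a $ i) at_top" and bot: "((\<lambda>t. \<gamma> t $ i) \<longlongrightarrow> b $ i) at_bot" for i
    using a b by (auto intro: tendsto_vec_nth)
  have p_top: "((\<lambda>t. \<gamma> t $ 3 + k * \<gamma> t $ 2) \<longlongrightarrow> a $ 3 + k * a $ 2) at_top"
    and p_bot: "((\<lambda>t. \<gamma> t $ 3 + k * \<gamma> t $ 2) \<longlongrightarrow> b $ 3 + k * b $ 2) at_bot"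
    by (intro tendsto_intros top bot)+
  \<comment> \<open>The limit points are equilibria.\<close>
  have rest: "a $ 4 = 0" "b $ 4 = 0" "a $ 3 + k * a $ 2 = 0" "b $ 3 + k * b $ 2 = 0"
    using limit_of_derivative_eq_0_at_top[OF d(2) top tendsto_minus[OF top]]
      limit_of_derivative_eq_0_at_bot[OF d(2) bot tendsto_minus[OF bot]]
      limit_of_derivative_eq_0_at_top[OF d(3) top p_top]
      limit_of_derivative_eq_0_at_bot[OF d(3) bot p_bot] by auto
  have u: "\<gamma> t \<in> level_set (coupled_energy k) c" "(\<gamma> t $ 1)\<^sup>2 > 0" for t
    using off by (auto simp: critical_surface_def critical_set_def)
  show False
  proof (rule forced_oscillator_not_at_rest_at_both_ends[OF k c d(1), of "\<lambda>t. \<gamma> t $ 3 + k * \<gamma> t $ 2"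
        "\<lambda>t. \<gamma> t $ 4" "a $ 2" "b $ 2"])
    show "((\<lambda>t. \<gamma> t $ 3 + k * \<gamma> t $ 2) has_real_derivative - \<gamma> t $ 4 + k * (2 * (\<gamma> t $ 1)\<^sup>2)) (at t)"
      for t
      by (intro DERIV_add DERIV_cmult d)
    show "(\<gamma> t $ 1)\<^sup>2 + (\<gamma> t $ 2)\<^sup>2 + ((\<gamma> t $ 3 + k * \<gamma> t $ 2)\<^sup>2 + (\<gamma> t $ 4)\<^sup>2) / 2 = c" for t
      using u(1)[of t] by (simp add: level_set_def coupled_energy_def)
    show "((\<lambda>t. (\<gamma> t $ 1)\<^sup>2) \<longlongrightarrow> 0) at_top" "((\<lambda>t. (\<gamma> t $ 1)\<^sup>2) \<longlongrightarrow> 0) at_bot"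
      using tendsto_power[OF top[of 1], of 2] tendsto_power[OF bot[of 1], of 2] a b by auto
  qed (use d(3) u(2) top[of 2] bot[of 2] p_top p_bot top[of 4] bot[of 4] rest in auto)
qed

theorem theorem5p1:
  shows "\<exists>(H :: real ^ 4 \<Rightarrow> real) (\<epsilon> :: real).
    smooth_on UNIV H \<and> \<epsilon> > 0 \<and>
    (\<forall>c\<in>{1 - \<epsilon><..<1 + \<epsilon>}.
       \<not> (\<exists>\<gamma>. singular_periodic_orbit H c \<gamma>) \<and>
       \<not> (\<exists>\<gamma>. periodic_orbit_off_critical H c \<gamma>) \<and>
       diffeomorphic_sets (level_set H c) (sphere (0 :: real ^ 4) 1))"
proof (intro exI conjI ballI)
  show "smooth_on UNIV (coupled_energy (1 / 10))"
    by (rule smooth_on_coupled_energy)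
  show "(1 / 2 :: real) > 0"
    by simp
  fix c :: real assume "c \<in> {1 - 1 / 2<..<1 + 1 / 2}"
  then have c: "c > 4 / 9"
    by simp
  show "\<not> (\<exists>\<gamma>. singular_periodic_orbit (coupled_energy (1 / 10)) c \<gamma>)"
    using no_singular_periodic_orbit_coupled_energy[OF _ _ c] by simp
  show "\<not> (\<exists>\<gamma>. periodic_orbit_off_critical (coupled_energy (1 / 10)) c \<gamma>)"
    using no_periodic_orbit_off_critical_coupled_energy by blast
  show "diffeomorphic_sets (level_set (coupled_energy (1 / 10)) c) (sphere (0 :: real ^ 4) 1)"
    using c by (intro level_set_coupled_energy_diffeomorphic_sphere) simp
qed

end
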